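(* Let $m\ge 0$ be an integer and $\alpha\in\mathbb{C}$ with $\operatorname{Re}(\alpha)>0$. Then $$\sum_{n=0}^{\infty}w_{n+m,\alpha}(x)\frac{t^{n}}{n!}=\left(\frac{1}{1-x(e^{t}-1)}\right)^{\alpha}w_{m,\alpha}\!\left(\frac{xe^{t}}{1-x(e^{t}-1)}\right)$$ as formal power series in $t$ with coefficients in $\mathbb{C}[x]$.
   Context: The general geometric polynomials are $w_{n,\alpha}(x)=\sum_{k=0}^{n}\genfrac{\{}{\}}{0pt}{}{n}{k}\binom{\alpha+k-1}{k}k!\,x^k$, where $\genfrac{\{}{\}}{0pt}{}{n}{k}$ are the Stirling numbers of the second kind and $\binom{\alpha+k-1}{k}=\frac{\alpha(\alpha+1)\cdots(\alpha+k-1)}{k!}$. The power $\left(\frac{1}{1-x(e^t-1)}\right)^\alpha$ is the power series in $t$ with constant term $1$, namely $\sum_{k\ge0}\binom{\alpha+k-1}{k}x^k(e^t-1)^k$. *)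

theory Defs
  imports
    Complex_Main
    "HOL-Computational_Algebra.Computational_Algebra"
    "HOL-Combinatorics.Stirling"
begin

definition geom_poly :: "complex \<Rightarrow> nat \<Rightarrow> complex poly" where
  "geom_poly \<alpha> n =
     (\<Sum>k=0..n. monom (of_nat (Stirling n k) * ((\<alpha> + of_nat k - 1) gchoose k) * fact k) k)"

text \<open>
  Power series in \<open>t\<close> over \<open>\<complex>[x]\<close> have type \<^typ>\<open>complex poly fps\<close>: \<open>t\<close> is the power series
  variable and \<open>x\<close> is the polynomial variable \<open>[:0, 1:]\<close>.
\<close>

abbreviation X :: "complex poly fps" where
  "X \<equiv> fps_const [:0, 1:]"

text \<open>
  The series \<open>e\<^sup>t\<close> with constant polynomials as coefficients; \<^const>\<open>fps_exp\<close> itself needs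
  coefficients in a field.
\<close>

definition exp_t :: "complex poly fps" where
  "exp_t = Abs_fps (\<lambda>n. [:fps_nth (fps_exp 1) n:])"

text \<open>
  The multiplicative inverse of \<open>1 - x (e\<^sup>t - 1)\<close>. The coefficient ring \<open>\<complex>[x]\<close> is not a field, so
  \<^const>\<open>inverse\<close> is not available; the second argument of \<open>fps_right_inverse\<close> is the inverse of
  the constant term, which is \<open>1\<close>.
\<close>

definition geom_base :: "complex poly fps" where
  "geom_base = fps_right_inverse (1 - X * (exp_t - 1)) 1"

lemma geom_base_inverse: "(1 - X * (exp_t - 1)) * geom_base = 1"
  unfolding geom_base_def by (rule fps_right_inverse) (simp add: exp_t_def one_pCons)

text \<open>
  The \<open>\<alpha>\<close>-th power of \<^const>\<open>geom_base\<close> with constant term \<open>1\<close>, i.e. the series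
  \<open>\<Sum>k. (\<alpha> + k - 1 gchoose k) * (x (e\<^sup>t - 1))\<^sup>k\<close>. The composition is this infinite sum because
  \<open>x (e\<^sup>t - 1)\<close> has constant term \<open>0\<close>.
\<close>

definition geom_power :: "complex \<Rightarrow> complex poly fps" where
  "geom_power \<alpha> = Abs_fps (\<lambda>k. [:(\<alpha> + of_nat k - 1) gchoose k:]) oo (X * (exp_t - 1))"

text \<open>Substitution of a power series over \<open>\<complex>[x]\<close> for the variable of a complex polynomial.\<close>

definition eval_fps_poly :: "complex poly \<Rightarrow> complex poly fps \<Rightarrow> complex poly fps" where
  "eval_fps_poly p z = poly (map_poly (\<lambda>c. fps_const [:c:]) p) z"

end

theory Submission
  imports Defs
begin

text \<open>
  Put \<open>z = x e\<^sup>t / (1 - x (e\<^sup>t - 1))\<close> and \<open>P = geom_power \<alpha>\<close>. Then \<open>z' = z + z\<^sup>2\<close> and \<open>P' = \<alpha> z P\<close>, so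
  \<open>(z\<^sup>k P)' = (k z\<^sup>k + (\<alpha> + k) z\<^sup>k\<^sup>+\<^sup>1) P\<close>. By the recurrence of the Stirling numbers, differentiating
  \<open>P w\<^sub>m(z)\<close> therefore gives \<open>P w\<^sub>m\<^sub>+\<^sub>1(z)\<close>, and \<open>P w\<^sub>m(z)\<close> is the \<open>m\<close>-th derivative of \<open>P\<close>. Since
  \<open>z = x\<close> at \<open>t = 0\<close>, comparing constant terms yields \<open>m! [t\<^sup>m] P = w\<^sub>m(x)\<close>, which determines all
  coefficients of the derivatives of \<open>P\<close>.
\<close>

lemma const_pCons_add: "fps_const [:a + b:] = fps_const [:a:] + fps_const [:b::'a::comm_ring_1:]"
  by simp

lemma const_pCons_mult: "fps_const [:a * b:] = fps_const [:a:] * fps_const [:b::'a::comm_ring_1:]"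
  by (simp add: mult.commute)

lemma gbinomial_shift_mult_fact:
  "((\<alpha> + of_nat k - 1) gchoose k) * fact k = pochhammer (\<alpha>::'a::field_char_0) k"
  by (simp add: gbinomial_pochhammer')

text \<open>Rising factorials suit differentiation: going from \<open>k\<close> to
  \<open>k + 1\<close> multiplies them by \<open>\<alpha> + k\<close>, the factor that the
  derivative of \<open>z^k * P\<close> produces.\<close>

lemma geom_poly_pochhammer:
  "geom_poly \<alpha> m = (\<Sum>k\<le>m. monom (of_nat (Stirling m k) * pochhammer \<alpha> k) k)"
  unfolding geom_poly_def atMost_atLeast0
  by (simp add: gbinomial_shift_mult_fact mult.assoc)

lemma eval_fps_poly_0 [simp]: "eval_fps_poly 0 z = 0"
  by (simp add: eval_fps_poly_def)

lemma eval_fps_poly_add: "eval_fps_poly (p + q) z = eval_fps_poly p z + eval_fps_poly q z"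
proof -
  have "map_poly (\<lambda>c. fps_const [:c:]) (p + q) =
      map_poly (\<lambda>c. fps_const [:c:]) p + map_poly (\<lambda>c. fps_const [:c:]) q"
    by (intro poly_eqI) (simp add: coeff_map_poly)
  then show ?thesis
    by (simp add: eval_fps_poly_def)
qed

lemma eval_fps_poly_sum: "eval_fps_poly (sum p A) z = (\<Sum>i\<in>A. eval_fps_poly (p i) z)"
  by (induction A rule: infinite_finite_induct) (simp_all add: eval_fps_poly_add)

lemma eval_fps_poly_monom: "eval_fps_poly (monom c k) z = fps_const [:c:] * z ^ k"
  by (simp add: eval_fps_poly_def map_poly_monom poly_monom)

lemma eval_fps_poly_geom_poly:
  "eval_fps_poly (geom_poly \<alpha> m) z =
     (\<Sum>k\<le>m. fps_const [:of_nat (Stirling m k) * pochhammer \<alpha> k:] * z ^ k)"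
  by (simp add: geom_poly_pochhammer eval_fps_poly_sum eval_fps_poly_monom)

text \<open>Taking constant terms is a ring homomorphism, so \<open>p(z)\<close> has constant term
  \<open>p(x) = p\<close>.\<close>

lemma nth_0_eval_fps_poly: "fps_nth z 0 = [:0, 1:] \<Longrightarrow> fps_nth (eval_fps_poly p z) 0 = p"
proof (induction p)
  case (pCons a p)
  have "eval_fps_poly (pCons a p) z = fps_const [:a:] + z * eval_fps_poly p z"
    using pCons.hyps by (simp add: eval_fps_poly_def map_poly_pCons)
  then show ?case
    using pCons by simp
qed simp

lemma deriv_exp_t: "fps_deriv exp_t = exp_t"
proof (rule fps_ext)
  fix n
  have "of_nat (Suc n) * (1 / fact (Suc n)) = (1 / fact n :: complex)"
    by (simp add: divide_simps del: of_nat_Suc)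
  then show "fps_nth (fps_deriv exp_t) n = fps_nth exp_t n"
    by (simp add: exp_t_def of_nat_poly del: of_nat_Suc fact_Suc)
qed

lemma nth_0_exp_t: "fps_nth exp_t 0 = 1"
  by (simp add: exp_t_def one_pCons)

lemma deriv_base_arg: "fps_deriv (X * (exp_t - 1)) = X * exp_t"
  by (simp add: deriv_exp_t)

lemma deriv_geom_base: "fps_deriv geom_base = X * exp_t * geom_base * geom_base"
proof -
  let ?a = "X * (exp_t - 1)"
  have "fps_deriv ((1 - ?a) * geom_base) = 0"
    by (simp only: geom_base_inverse fps_deriv_1)
  then have *: "(1 - ?a) * fps_deriv geom_base = X * exp_t * geom_base"
    by (simp only: fps_deriv_mult[of "1 - ?a"] fps_deriv_sub[of 1] fps_deriv_1 deriv_base_arg) algebra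
  \<comment> \<open>Multiplication by \<open>geom_base\<close> stands in for division by
    \<open>1 - ?a\<close>.\<close>
  have "fps_deriv geom_base = ((1 - ?a) * geom_base) * fps_deriv geom_base"
    by (simp only: geom_base_inverse mult_1)
  also have "\<dots> = geom_base * ((1 - ?a) * fps_deriv geom_base)"
    by (simp only: ac_simps)
  also have "\<dots> = geom_base * (X * exp_t * geom_base)"
    by (simp only: *)
  finally show ?thesis
    by (simp only: ac_simps)
qed

text \<open>The series \<open>z\<close> of the overview.\<close>

definition geom_arg :: "complex poly fps" where
  "geom_arg = X * exp_t * geom_base"

lemma nth_0_geom_arg: "fps_nth geom_arg 0 = [:0, 1:]"
  by (simp add: geom_arg_def geom_base_def nth_0_exp_t)

text \<open>In the product rule, differentiating \<open>exp_t\<close> gives back \<open>z\<close>,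
  and differentiating \<open>geom_base\<close> gives
  \<open>(X * exp_t * geom_base)^2 = z^2\<close>.\<close>

lemma deriv_geom_arg: "fps_deriv geom_arg = geom_arg + geom_arg ^ 2"
  unfolding geom_arg_def
  by (simp only: fps_deriv_mult fps_deriv_const deriv_exp_t deriv_geom_base) algebra

text \<open>The series \<open>G = (1 - u)\<^sup>-\<^sup>\<alpha>\<close> satisfies \<open>(1 - u) G' = \<alpha> G\<close>.\<close>

lemma deriv_geom_power: "fps_deriv (geom_power \<alpha>) = fps_const [:\<alpha>:] * geom_arg * geom_power \<alpha>"
proof -
  define G where "G = Abs_fps (\<lambda>k. [:(\<alpha> + of_nat k - 1) gchoose k:])"
  define a where "a = X * (exp_t - 1)"
  have a0: "fps_nth a 0 = 0"
    by (simp add: a_def nth_0_exp_t)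
  have G: "(1 - fps_X) * fps_deriv G = fps_const [:\<alpha>:] * G"
  proof (rule fps_ext)
    fix n
    define g where "g k = ((\<alpha> + of_nat k - 1) gchoose k)" for k
    have g: "g k = pochhammer \<alpha> k / fact k" for k
      by (simp add: g_def gbinomial_pochhammer')
    have step: "of_nat (Suc k) * g (Suc k) = (\<alpha> + of_nat k) * g k" for k
      by (simp add: g pochhammer_Suc field_simps del: of_nat_Suc)
    \<comment> \<open>For \<open>n = 0\<close> the term shifted by \<open>fps_X\<close> is absent,
      in agreement with the factor \<open>of_nat n\<close>.\<close>
    have "fps_nth ((1 - fps_X) * fps_deriv G) n =
        of_nat (Suc n) * [:g (Suc n):] - of_nat n * [:g n:]"
      by (cases n) (simp_all add: G_def g_def algebra_simps)
    also have "\<dots> = [:of_nat (Suc n) * g (Suc n) - of_nat n * g n:]"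
      by (simp add: of_nat_poly del: of_nat_Suc)
    also have "\<dots> = [:\<alpha> * g n:]"
      by (simp only: step) (simp add: algebra_simps)
    finally show "fps_nth ((1 - fps_X) * fps_deriv G) n = fps_nth (fps_const [:\<alpha>:] * G) n"
      by (simp add: G_def g_def)
  qed
  \<comment> \<open>The differential equation survives the substitution of \<open>a\<close>:
    composition is multiplicative since \<open>a\<close> has constant term 0.\<close>
  have "(1 - a) * (fps_deriv G oo a) = ((1 - fps_X) * fps_deriv G) oo a"
    by (simp add: fps_compose_mult_distrib fps_compose_sub_distrib a0)
  then have *: "(1 - a) * (fps_deriv G oo a) = fps_const [:\<alpha>:] * geom_power \<alpha>"
    by (simp only: G fps_compose_mult_distrib[OF a0] fps_const_compose)
      (simp add: geom_power_def G_def a_def)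
  have "fps_deriv G oo a = geom_base * ((1 - a) * (fps_deriv G oo a))"
    using geom_base_inverse by (simp add: a_def mult.assoc[symmetric] mult.commute)
  then have "fps_deriv G oo a = geom_base * (fps_const [:\<alpha>:] * geom_power \<alpha>)"
    by (simp only: *)
  \<comment> \<open>Chain rule; its factor \<open>X * exp_t\<close> joins \<open>geom_base\<close>
    to form \<open>geom_arg\<close>.\<close>
  moreover have "fps_deriv (geom_power \<alpha>) = (fps_deriv G oo a) * (X * exp_t)"
    using fps_compose_deriv[OF a0, of G] deriv_base_arg by (simp add: geom_power_def G_def a_def)
  ultimately show ?thesis
    by (simp only: geom_arg_def ac_simps)
qed

lemma deriv_geom_arg_power_mult:
  "fps_deriv (geom_arg ^ k * geom_power \<alpha>) =
    (fps_const [:of_nat k:] * geom_arg ^ k + fps_const [:\<alpha> + of_nat k:] * geom_arg ^ Suc k)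
      * geom_power \<alpha>"
proof -
  have "fps_deriv (geom_arg ^ k) = of_nat k * (geom_arg ^ k + geom_arg ^ Suc k)"
  \<comment> \<open>The power rule involves the exponent \<open>k - 1\<close>, so
    \<open>k = 0\<close> is treated apart.\<close>
  proof (cases k)
    case (Suc j)
    then show ?thesis
      by (simp only: fps_deriv_power' deriv_geom_arg diff_Suc_1)
        (simp only: power_Suc power2_eq_square distrib_left distrib_right ac_simps)
  qed simp
  moreover have "of_nat k = fps_const [:of_nat k :: complex:]"
    by (simp add: of_nat_poly fps_of_nat[symmetric])
  ultimately have k: "fps_deriv (geom_arg ^ k) =
      fps_const [:of_nat k:] * (geom_arg ^ k + geom_arg ^ Suc k)"
    by simp
  show ?thesis
    by (simp only: fps_deriv_mult k deriv_geom_power const_pCons_add power_Suc) algebra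
qed

lemma deriv_geom_power_mult_eval:
  "fps_deriv (geom_power \<alpha> * eval_fps_poly (geom_poly \<alpha> m) geom_arg) =
     geom_power \<alpha> * eval_fps_poly (geom_poly \<alpha> (Suc m)) geom_arg"
proof -
  define c where "c k = of_nat (Stirling m k) * pochhammer \<alpha> k" for k
  \<comment> \<open>\<open>f\<close> and \<open>g\<close> are the two terms of the derivative of
    \<open>c k * z^k * P\<close>, with the factor \<open>P\<close> removed.\<close>
  define f where "f k = fps_const [:of_nat k * c k:] * geom_arg ^ k" for k
  define g where "g k = fps_const [:(\<alpha> + of_nat k) * c k:] * geom_arg ^ Suc k" for k
  \<comment> \<open>Both boundary terms vanish: \<open>f 0\<close> by its factor 0,
    \<open>f (Suc m)\<close> because \<open>Stirling m (Suc m) = 0\<close>.\<close>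
  have shift: "(\<Sum>k\<le>m. f (Suc k)) = (\<Sum>k\<le>m. f k)"
  proof -
    have "f 0 + (\<Sum>k\<le>m. f (Suc k)) = (\<Sum>k\<le>m. f k) + f (Suc m)"
      by (simp only: sum.atMost_Suc_shift[symmetric] sum.atMost_Suc)
    moreover have "f 0 = 0" "f (Suc m) = 0"
      by (simp_all add: f_def c_def)
    ultimately show ?thesis
      by simp
  qed
  \<comment> \<open>The lowest term drops out because \<open>Stirling (Suc m) 0 = 0\<close>.\<close>
  have "eval_fps_poly (geom_poly \<alpha> (Suc m)) geom_arg =
      (\<Sum>k\<le>m. fps_const [:of_nat (Stirling (Suc m) (Suc k)) * pochhammer \<alpha> (Suc k):]
        * geom_arg ^ Suc k)"
    by (simp only: eval_fps_poly_geom_poly sum.atMost_Suc_shift) simp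
  also have "\<dots> = (\<Sum>k\<le>m. f (Suc k) + g k)"
  proof (rule sum.cong)
    fix k
    \<comment> \<open>Stirling recurrence \<open>S(m+1,k+1) = (k+1) S(m,k+1) + S(m,k)\<close>; only
      in the second term is the factor \<open>\<alpha> + k\<close> split off the rising
      factorial.\<close>
    have "of_nat (Stirling (Suc m) (Suc k)) * pochhammer \<alpha> (Suc k) =
        of_nat (Suc k) * c (Suc k) + (\<alpha> + of_nat k) * c k"
      by (simp add: c_def pochhammer_Suc algebra_simps)
    then show "fps_const [:of_nat (Stirling (Suc m) (Suc k)) * pochhammer \<alpha> (Suc k):]
        * geom_arg ^ Suc k = f (Suc k) + g k"
      by (simp only: f_def g_def const_pCons_add distrib_right)
  qed simp
  also have "\<dots> = (\<Sum>k\<le>m. f k + g k)"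
    by (simp only: sum.distrib shift)
  finally have eval_Suc: "eval_fps_poly (geom_poly \<alpha> (Suc m)) geom_arg = (\<Sum>k\<le>m. f k + g k)" .
  have "geom_power \<alpha> * eval_fps_poly (geom_poly \<alpha> m) geom_arg =
      (\<Sum>k\<le>m. fps_const [:c k:] * (geom_arg ^ k * geom_power \<alpha>))"
    by (simp only: eval_fps_poly_geom_poly c_def sum_distrib_left ac_simps)
  then have "fps_deriv (geom_power \<alpha> * eval_fps_poly (geom_poly \<alpha> m) geom_arg) =
      (\<Sum>k\<le>m. fps_const [:c k:] * fps_deriv (geom_arg ^ k * geom_power \<alpha>))"
    by (simp only: fps_deriv_sum fps_deriv_mult_const_left)
  also have "\<dots> = (\<Sum>k\<le>m. geom_power \<alpha> * (f k + g k))"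
    by (intro sum.cong refl)
      (simp only: deriv_geom_arg_power_mult f_def g_def const_pCons_mult, algebra)
  finally show ?thesis
    by (simp only: eval_Suc sum_distrib_left)
qed

lemma higher_deriv_geom_power:
  "(fps_deriv ^^ m) (geom_power \<alpha>) = geom_power \<alpha> * eval_fps_poly (geom_poly \<alpha> m) geom_arg"
proof (induction m)
  case 0
  show ?case
    by (simp add: eval_fps_poly_geom_poly one_pCons[symmetric])
next
  case (Suc m)
  then show ?case
    by (simp only: funpow.simps o_apply deriv_geom_power_mult_eval)
qed

text \<open>At \<open>t = 0\<close> the series \<open>P\<close> is 1 and \<open>z\<close> is
  \<open>x\<close>, so the substituted polynomial can be read off.\<close>

lemma nth_0_geom_power_mult_eval:
  "fps_nth (geom_power \<alpha> * eval_fps_poly p geom_arg) 0 = p"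
  by (simp add: geom_power_def nth_0_eval_fps_poly nth_0_geom_arg one_pCons[symmetric])

theorem theorem5:
  fixes m :: nat and \<alpha> :: complex
  assumes "Re \<alpha> > 0"
  shows "Abs_fps (\<lambda>n. smult (1 / fact n) (geom_poly \<alpha> (n + m))) =
         geom_power \<alpha> * eval_fps_poly (geom_poly \<alpha> m) (X * exp_t * geom_base)"
proof (rule fps_ext)
  fix n
  let ?R = "geom_power \<alpha> * eval_fps_poly (geom_poly \<alpha> m) geom_arg"
  have "fact n * fps_nth ?R n = fps_nth ((fps_deriv ^^ n) ?R) 0"
    by (simp only: fps_0th_higher_deriv)
  \<comment> \<open>\<open>?R\<close> is already the \<open>m\<close>-th derivative of
    \<open>P\<close>, so the orders of differentiation add up.\<close>
  also have "(fps_deriv ^^ n) ?R = (fps_deriv ^^ (n + m)) (geom_power \<alpha>)"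
    by (simp only: higher_deriv_geom_power[symmetric] funpow_add o_apply)
  also have "fps_nth \<dots> 0 = geom_poly \<alpha> (n + m)"
    by (simp only: higher_deriv_geom_power nth_0_geom_power_mult_eval)
  \<comment> \<open>In the polynomial ring \<open>fact n\<close> is a constant polynomial; as a
    scalar it can be divided out.\<close>
  finally have "geom_poly \<alpha> (n + m) = smult (fact n) (fps_nth ?R n)"
    by (metis of_nat_fact of_nat_poly mult_pCons_left mult_zero_left pCons_0_0 add_0_right)
  then show "fps_nth (Abs_fps (\<lambda>n. smult (1 / fact n) (geom_poly \<alpha> (n + m)))) n =
      fps_nth (geom_power \<alpha> * eval_fps_poly (geom_poly \<alpha> m) (X * exp_t * geom_base)) n"
    by (simp add: geom_arg_def)
qed

end
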